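(* For every positive integer $n$, the integer $\{2\}$-domination number of the grid graph $G_{2,n}$ is $$\gamma_{\{2\}}(G_{2,n}) = n+1.$$
   Context: For positive integers $m,n$, the grid graph $G_{m,n}=P_m\square P_n$ has vertex set $\{v_{i,j}: 1\le i\le m,\ 1\le j\le n\}$, where $v_{i_1,j_1}v_{i_2,j_2}$ is an edge iff ($|i_1-i_2|=1$ and $j_1=j_2$) or ($i_1=i_2$ and $|j_1-j_2|=1$). For a graph $G=(V,E)$ and $v\in V$, $N[v]$ denotes the closed neighborhood of $v$. An integer $\{2\}$-dominating function of $G$ is a function $f:V\to\mathbb{Z}_{\ge 0}$ with $\sum_{y\in N[x]} f(y)\ge 2$ for every $x\in V$; the integer $\{2\}$-domination number $\gamma_{\{2\}}(G)$ is the minimum of $\sum_{x\in V} f(x)$ over all integer $\{2\}$-dominating functions $f$ of $G$. *)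

theory Defs
  imports "Graph_Theory.Pair_Digraph"
begin

text \<open>
  Undirected simple graphs are symmetric loop-free pair digraphs (locale \<^locale>\<open>pair_graph\<close>):
  the edge $uv$ is represented by the two arcs $(u,v)$ and $(v,u)$.
\<close>

definition closed_nbhd :: "'a pair_pre_digraph \<Rightarrow> 'a \<Rightarrow> 'a set" where
  "closed_nbhd G v = insert v {u \<in> pverts G. (v, u) \<in> parcs G}"

text \<open>
  A function $V \to Z_{\ge 0}$ is a total function into \<^typ>\<open>nat\<close>; its values outside
  the vertex set play no role.
\<close>

definition two_dominating :: "'a pair_pre_digraph \<Rightarrow> ('a \<Rightarrow> nat) \<Rightarrow> bool" where
  "two_dominating G f \<longleftrightarrow> (\<forall>x \<in> pverts G. (\<Sum>y \<in> closed_nbhd G x. f y) \<ge> 2)"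

text \<open>Meaningful for finite graphs, where the minimum exists (see the lemmas below).\<close>

definition two_domination_number :: "'a pair_pre_digraph \<Rightarrow> nat" where
  "two_domination_number G =
     (LEAST k. \<exists>f. two_dominating G f \<and> k = (\<Sum>x \<in> pverts G. f x))"

definition grid_graph :: "nat \<Rightarrow> nat \<Rightarrow> (nat \<times> nat) pair_pre_digraph" where
  "grid_graph m n =
     \<lparr> pverts = {1..m} \<times> {1..n},
       parcs = {((i1, j1), (i2, j2)) | i1 j1 i2 j2.
          (i1, j1) \<in> {1..m} \<times> {1..n} \<and> (i2, j2) \<in> {1..m} \<times> {1..n} \<and>
          ((\<bar>int i1 - int i2\<bar> = 1 \<and> j1 = j2) \<or> (i1 = i2 \<and> \<bar>int j1 - int j2\<bar> = 1))} \<rparr>"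

lemma pair_graph_grid_graph: "pair_graph (grid_graph m n)"
proof -
  let ?G = "grid_graph m n"
  have "parcs ?G \<subseteq> pverts ?G \<times> pverts ?G"
    by (auto simp: grid_graph_def)
  moreover have "finite (pverts ?G)"
    by (simp add: grid_graph_def)
  ultimately have "finite (parcs ?G)"
    by (meson finite_SigmaI finite_subset)
  moreover have "sym (parcs ?G)"
    by (auto simp: grid_graph_def sym_def)
  ultimately show ?thesis
    by unfold_locales
      (auto simp: grid_graph_def symmetric_def arcs_ends_def arc_to_ends_def sym_def image_def)
qed

lemma two_dominating_const_2:
  assumes "pair_fin_digraph G"
  shows "two_dominating G (\<lambda>_. 2)"
proof -
  interpret pair_fin_digraph G by fact
  have "card (closed_nbhd G x) \<ge> 1" for x
    unfolding closed_nbhd_def by (simp add: card_insert_if card_gt_0_iff Suc_le_eq) auto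
  then show ?thesis
    by (simp add: two_dominating_def)
qed

lemma two_domination_number_attained:
  assumes "pair_fin_digraph G"
  obtains f where "two_dominating G f" "two_domination_number G = (\<Sum>x \<in> pverts G. f x)"
proof -
  have "\<exists>k f. two_dominating G f \<and> k = (\<Sum>x \<in> pverts G. f x)"
    using two_dominating_const_2[OF assms] by blast
  from LeastI_ex[OF this] show thesis
    using that unfolding two_domination_number_def by blast
qed

lemma two_domination_number_le:
  assumes "two_dominating G f"
  shows "two_domination_number G \<le> (\<Sum>x \<in> pverts G. f x)"
  unfolding two_domination_number_def using assms by (blast intro: Least_le)

end

theory Submission
  imports Defs
begin

text \<open>
  Adding the two domination conditions of column $j$ gives $c_{j-1} + 2 c_j + c_{j+1} \ge 4$ for
  the column sums $c_j$, where $c_0 = c_{n+1} = 0$. The lower bound is linear programming duality: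
  nonnegative multipliers $u_j$ with $u_0 = u_{n+1} = 0$ and $u_{j-1} + 2 u_j + u_{j+1} = K$ give
  $K \sum c_j \ge 4 \sum u_j$. For odd $n$ take $u = 1, 0, 1, \dots, 0, 1$ with $K = 2$, which gives
  $\sum c_j \ge n + 1$. For even $n$ take $u_j = j$ for even $j$ and $u_j = n + 1 - j$ for odd $j$
  with $K = 2(n + 1)$, which gives $\sum c_j \ge n(n+2)/(n+1) > n$. Equality is attained by ones on
  every second column, ending with the last one, and for even $n$ one more in the first column.
\<close>

text \<open>A closed neighborhood is the full column \<open>j\<close> plus the horizontal neighbors
  in row \<open>i\<close>. Extending \<open>f\<close> by zero to \<open>g\<close> lets columns 0 and
  \<open>n + 1\<close> stand in for missing neighbors, so end columns need no separate case.\<close>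

lemma sum_closed_nbhd_ladder:
  fixes f g :: "nat \<times> nat \<Rightarrow> nat"
  assumes i: "i \<in> {1..2}" and j: "j \<in> {1..n}"
    and g: "\<And>x. g x = (if x \<in> {1..2} \<times> {1..n} then f x else 0)"
  shows "(\<Sum>y \<in> closed_nbhd (grid_graph 2 n) (i, j). f y) =
    g (1, j) + g (2, j) + g (i, j - 1) + g (i, j + 1)"
proof -
  let ?V = "{1..2::nat} \<times> {1..n}"
  let ?S = "{(1, j), (2, j), (i, j - 1), (i, j + 1)}"
  have "closed_nbhd (grid_graph 2 n) (i, j) = ?S \<inter> ?V"
    using i j unfolding closed_nbhd_def grid_graph_def by auto
  then have "(\<Sum>y \<in> closed_nbhd (grid_graph 2 n) (i, j). f y) = (\<Sum>y\<in>?S. g y)"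
    by (simp only: g sum.inter_restrict finite.intros)
  also have "\<dots> = g (1, j) + g (2, j) + g (i, j - 1) + g (i, j + 1)"
  proof -
    \<comment> \<open>Since \<open>j\<close> is positive, truncated subtraction gives
      \<open>j - 1\<close> \<noteq> \<open>j\<close>, so the four cells are distinct.\<close>
    obtain k where "j = Suc k"
      using j by (cases j) auto
    moreover have "i = 1 \<or> i = 2"
      using i by auto
    ultimately show ?thesis by auto
  qed
  finally show ?thesis .
qed

lemma two_dominating_ladder_iff:
  fixes f g :: "nat \<times> nat \<Rightarrow> nat"
  assumes "\<And>x. g x = (if x \<in> {1..2} \<times> {1..n} then f x else 0)"
  shows "two_dominating (grid_graph 2 n) f \<longleftrightarrow>
    (\<forall>i\<in>{1..2}. \<forall>j\<in>{1..n}. 2 \<le> g (1, j) + g (2, j) + g (i, j - 1) + g (i, j + 1))"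
proof -
  have V: "pverts (grid_graph 2 n) = {1..2} \<times> {1..n}"
    by (simp add: grid_graph_def)
  show ?thesis
    unfolding two_dominating_def V using sum_closed_nbhd_ladder[OF _ _ assms] by force
qed

lemma sum_pverts_ladder:
  fixes f :: "nat \<times> nat \<Rightarrow> nat"
  shows "(\<Sum>x \<in> pverts (grid_graph 2 n). f x) = (\<Sum>j=1..n. f (1, j) + f (2, j))"
proof -
  have "(\<Sum>x \<in> pverts (grid_graph 2 n). f x) = (\<Sum>i\<in>{1..2}. \<Sum>j=1..n. f (i, j))"
    by (simp add: grid_graph_def sum.cartesian_product)
  also have "{1..2} = {1, 2::nat}" by auto
  finally show ?thesis by (simp add: sum.distrib)
qed

text \<open>The operator with coefficients 1, 2, 1 is symmetric, so it can be moved from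
  \<open>c\<close> to \<open>u\<close>, where it is constant. The boundary terms are kept because
  they vanish only at the right end \<open>k = n\<close>.\<close>

lemma ladder_summation_by_parts:
  fixes u c :: "nat \<Rightarrow> int"
  assumes "u 0 = 0" "c 0 = 0"
    and u: "\<And>j. u j + 2 * u (Suc j) + u (Suc (Suc j)) = K"
  shows "(\<Sum>j<k. u (Suc j) * (c j + 2 * c (Suc j) + c (Suc (Suc j)))) =
    K * (\<Sum>j<k. c (Suc j)) + u k * c (Suc k) - u (Suc k) * c k"
proof (induction k)
  case (Suc k)
  have "K * c (Suc k) = (u k + 2 * u (Suc k) + u (Suc (Suc k))) * c (Suc k)"
    by (simp add: u)
  with Suc show ?case by (simp add: algebra_simps)
qed (use assms in simp)

lemma ladder_weak_duality:
  fixes u c :: "nat \<Rightarrow> int"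
  assumes "u 0 = 0" "u (Suc n) = 0" "c 0 = 0" "c (Suc n) = 0"
    and u: "\<And>j. u j + 2 * u (Suc j) + u (Suc (Suc j)) = K"
    and u_nonneg: "\<And>j. j < n \<Longrightarrow> 0 \<le> u (Suc j)"
    and c: "\<And>j. j < n \<Longrightarrow> 4 \<le> c j + 2 * c (Suc j) + c (Suc (Suc j))"
  shows "4 * (\<Sum>j<n. u (Suc j)) \<le> K * (\<Sum>j<n. c (Suc j))"
proof -
  have "4 * (\<Sum>j<n. u (Suc j)) = (\<Sum>j<n. u (Suc j) * 4)"
    by (simp add: sum_distrib_left mult.commute)
  also have "\<dots> \<le> (\<Sum>j<n. u (Suc j) * (c j + 2 * c (Suc j) + c (Suc (Suc j))))"
    by (intro sum_mono mult_left_mono) (use u_nonneg c in auto)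
  also have "\<dots> = K * (\<Sum>j<n. c (Suc j))"
    using ladder_summation_by_parts[of u c K n] assms by simp
  finally show ?thesis .
qed

lemma ladder_column_sum_lower_bound:
  fixes c :: "nat \<Rightarrow> int"
  assumes "n \<ge> 1" "c 0 = 0" "c (Suc n) = 0"
    and c: "\<And>j. j < n \<Longrightarrow> 4 \<le> c j + 2 * c (Suc j) + c (Suc (Suc j))"
  shows "int n + 1 \<le> (\<Sum>j<n. c (Suc j))"
proof (cases "even n")
  case False
  then obtain m where n: "n = Suc (2 * m)"
    by (auto elim: oddE)
  define u :: "nat \<Rightarrow> int" where "u j = (if even j then 0 else 1)" for j
  have "(\<Sum>j<Suc (2 * m). u (Suc j)) = int m + 1"
    by (induction m) (auto simp: u_def)
  moreover have "4 * (\<Sum>j<n. u (Suc j)) \<le> 2 * (\<Sum>j<n. c (Suc j))"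
    by (rule ladder_weak_duality) (use assms False in \<open>auto simp: u_def\<close>)
  ultimately show ?thesis by (simp add: n)
next
  case True
  then obtain m where n: "n = 2 * m"
    by (auto elim: evenE)
  \<comment> \<open>Here \<open>n + 1\<close> is odd, hence \<open>u (Suc n) = 0\<close>. Beyond
    that index odd entries are negative, but the sign matters only up to \<open>n\<close>.\<close>
  define u :: "nat \<Rightarrow> int" where "u j = (if even j then int j else int n + 1 - int j)" for j
  \<comment> \<open>Each pair \<open>u (2 * i + 1)\<close>, \<open>u (2 * i + 2)\<close> adds up to
    \<open>n + 2\<close>.\<close>
  have "(\<Sum>j<2 * k. u (Suc j)) = int k * (int n + 2)" for k
    by (induction k) (auto simp: u_def algebra_simps)
  then have "(\<Sum>j<n. u (Suc j)) = int m * (int n + 2)"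
    by (simp only: n)
  moreover have "4 * (\<Sum>j<n. u (Suc j)) \<le> (2 * (int n + 1)) * (\<Sum>j<n. c (Suc j))"
    by (rule ladder_weak_duality) (use assms True in \<open>auto simp: u_def\<close>)
  ultimately have *: "int n * (int n + 2) \<le> (int n + 1) * (\<Sum>j<n. c (Suc j))"
    by (simp add: n algebra_simps)
  have "(int n + 1) * int n < int n * (int n + 2)"
    using \<open>n \<ge> 1\<close> by (simp add: algebra_simps)
  with * have "(int n + 1) * int n < (int n + 1) * (\<Sum>j<n. c (Suc j))"
    by linarith
  then have "int n < (\<Sum>j<n. c (Suc j))"
    by (simp add: mult_less_cancel_left)
  then show ?thesis by simp
qed

lemma two_dominating_ladder_lower_bound:
  assumes "n \<ge> 1" and f: "two_dominating (grid_graph 2 n) f"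
  shows "n + 1 \<le> (\<Sum>x \<in> pverts (grid_graph 2 n). f x)"
proof -
  define g where "g x = (if x \<in> {1..2} \<times> {1..n} then f x else 0)" for x
  \<comment> \<open>Using \<open>g\<close> rather than \<open>f\<close> makes \<open>c 0\<close> and
    \<open>c (Suc n)\<close> vanish.\<close>
  define c where "c j = int (g (1, j) + g (2, j))" for j
  have g: "2 \<le> g (1, j) + g (2, j) + g (i, j - 1) + g (i, j + 1)"
    if "i \<in> {1..2}" "j \<in> {1..n}" for i j
    using f that two_dominating_ladder_iff[OF g_def] by blast
  have "int n + 1 \<le> (\<Sum>j<n. c (Suc j))"
  proof (rule ladder_column_sum_lower_bound)
    show "4 \<le> c j + 2 * c (Suc j) + c (Suc (Suc j))" if "j < n" for j
      using g[of 1 "Suc j"] g[of 2 "Suc j"] that by (simp add: c_def)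
  qed (use assms in \<open>auto simp: c_def g_def\<close>)
  also have "(\<Sum>j<n. c (Suc j)) = int (\<Sum>j=1..n. f (1, j) + f (2, j))"
    unfolding of_nat_sum
    by (rule sum.reindex_bij_witness[of _ "\<lambda>j. j - 1" Suc]) (auto simp: c_def g_def)
  finally show ?thesis
    unfolding sum_pverts_ladder by linarith
qed

text \<open>For odd \<open>n\<close> the first column is already full, so the second disjunct
  changes the value only for even \<open>n\<close>.\<close>

definition ladder_dominating :: "nat \<Rightarrow> nat \<times> nat \<Rightarrow> nat" where
  "ladder_dominating n = (\<lambda>(i, j). if even (n + j) \<or> i = 1 \<and> j = 1 then 1 else 0)"

lemma two_dominating_ladder_dominating:
  "two_dominating (grid_graph 2 n) (ladder_dominating n)"
proof -
  define g where "g x = (if x \<in> {1..2} \<times> {1..n} then ladder_dominating n x else 0)" for x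
  have "2 \<le> g (1, j) + g (2, j) + g (i, j - 1) + g (i, j + 1)"
    if i: "i \<in> {1..2}" and j: "j \<in> {1..n}" for i j
  proof (cases "even (n + j)")
    case True
    then have "g (1, j) = 1" "g (2, j) = 1"
      using j by (auto simp: g_def ladder_dominating_def)
    then show ?thesis by simp
  next
    case False
    \<comment> \<open>The last column has even \<open>n + j\<close>, so an empty-parity column
      always has a full column to its right.\<close>
    then have "j + 1 \<le> n"
      using j by (cases "j = n") auto
    with False have right: "g (i, j + 1) = 1"
      using i by (auto simp: g_def ladder_dominating_def)
    show ?thesis
    proof (cases "j = 1")
      \<comment> \<open>With no column to the left, the extra one at (1, 1) supplies the missing
        unit to both cells of column 1.\<close>
      case True
      then have "g (1, j) = 1"
        using j by (simp add: g_def ladder_dominating_def)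
      with right show ?thesis by simp
    next
      case j1: False
      then have "g (i, j - 1) = 1"
        using False i j by (auto simp: g_def ladder_dominating_def)
      with right show ?thesis by simp
    qed
  qed
  then show ?thesis
    using two_dominating_ladder_iff[OF g_def] by blast
qed

lemma sum_ladder_dominating:
  assumes "n \<ge> 1"
  shows "(\<Sum>x \<in> pverts (grid_graph 2 n). ladder_dominating n x) = n + 1"
proof -
  let ?s = "\<lambda>n. \<Sum>j=1..n. ladder_dominating n (1, j) + ladder_dominating n (2, j)"
  \<comment> \<open>Raising \<open>n\<close> by two preserves the parity of \<open>n + j\<close>,
    and of the two new columns only the last is full. For \<open>k = 0\<close> the extra one in
    column 1 would also be new, hence the two base cases below.\<close>
  have step: "?s (Suc (Suc k)) = ?s k + 2" if "k \<ge> 1" for k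
    using that by (simp add: ladder_dominating_def)
  have "?s n = n + 1"
    using assms
  proof (induction n rule: less_induct)
    case (less n)
    consider "n = 1" | "n = 2" | k where "n = Suc (Suc k)" "k \<ge> 1"
      using less.prems by (metis One_nat_def Suc_1 not0_implies_Suc not_less_eq_eq le0)
    then show ?case
    proof cases
      case 2
      moreover have "{1..2::nat} = {1, 2}" by auto
      ultimately show ?thesis by (simp add: ladder_dominating_def)
    next
      case 3
      with less.IH[of k] have "?s k = k + 1" by simp
      with 3 step[of k] show ?thesis by simp
    qed (simp add: ladder_dominating_def)
  qed
  then show ?thesis
    by (simp only: sum_pverts_ladder)
qed

theorem theorem2p3:
  fixes n :: nat
  assumes "n \<ge> 1"
  shows "two_domination_number (grid_graph 2 n) = n + 1"
proof (rule antisym)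
  show "two_domination_number (grid_graph 2 n) \<le> n + 1"
    using two_domination_number_le[OF two_dominating_ladder_dominating]
      sum_ladder_dominating[OF assms] by metis
  have "pair_fin_digraph (grid_graph 2 n)"
    by (intro pair_digraph.axioms(1) pair_graph.axioms(1) pair_graph_grid_graph)
  then obtain f where "two_dominating (grid_graph 2 n) f"
    "two_domination_number (grid_graph 2 n) = (\<Sum>x \<in> pverts (grid_graph 2 n). f x)"
    by (rule two_domination_number_attained)
  then show "n + 1 \<le> two_domination_number (grid_graph 2 n)"
    using two_dominating_ladder_lower_bound[OF assms] by metis
qed

end
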